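(* Every class-1 graph that is $3$-regular or $4$-regular has an external bisection.
   Context: Graphs are finite and simple. A $d$-regular graph is class-1 if its edges can be properly colored with $d$ colors (its chromatic index equals $d$). For $S\subseteq V$, $d_S(v)$ is the number of neighbors of $v$ in $S$ and $d(v)$ the degree of $v$. An external partition is a partition $V=A\dot\cup B$ with $A,B\ne\emptyset$ such that $d_B(x)\ge d(x)/2$ for all $x\in A$ and $d_A(x)\ge d(x)/2$ for all $x\in B$; an external bisection is an external partition with $|A|=|B|$. *)

theory Defs
  imports Complex_Main "Graph_Theory.Pair_Digraph"
begin

text \<open>
  A finite simple graph is a \<open>pair_graph\<close>: finite vertex and arc sets and a symmetric,
  irreflexive arc relation. Each undirected edge is thus represented by two opposite arcs;
  wherever edges themselves matter (colourings) we pass to the set of two-element vertex sets.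
\<close>

definition edges :: "'a pair_pre_digraph \<Rightarrow> 'a set set" where
  "edges G = {{u, v} | u v. (u, v) \<in> parcs G}"

definition degree_in :: "'a pair_pre_digraph \<Rightarrow> 'a set \<Rightarrow> 'a \<Rightarrow> nat" where
  "degree_in G S v = card {u \<in> S. (v, u) \<in> parcs G}"

definition degree :: "'a pair_pre_digraph \<Rightarrow> 'a \<Rightarrow> nat" where
  "degree G v = degree_in G (pverts G) v"

definition regular_graph :: "nat \<Rightarrow> 'a pair_pre_digraph \<Rightarrow> bool" where
  "regular_graph d G \<longleftrightarrow> (\<forall>v \<in> pverts G. degree G v = d)"

definition proper_edge_coloring :: "'a pair_pre_digraph \<Rightarrow> nat \<Rightarrow> ('a set \<Rightarrow> nat) \<Rightarrow> bool" where
  "proper_edge_coloring G k c \<longleftrightarrow>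
     (\<forall>e \<in> edges G. c e < k) \<and>
     (\<forall>e \<in> edges G. \<forall>f \<in> edges G. e \<noteq> f \<and> e \<inter> f \<noteq> {} \<longrightarrow> c e \<noteq> c f)"

definition edge_colorable :: "'a pair_pre_digraph \<Rightarrow> nat \<Rightarrow> bool" where
  "edge_colorable G k \<longleftrightarrow> (\<exists>c. proper_edge_coloring G k c)"

definition chromatic_index :: "'a pair_pre_digraph \<Rightarrow> nat" where
  "chromatic_index G = (LEAST k. edge_colorable G k)"

text \<open>
  The degree \<open>d\<close> is determined by \<open>G\<close> as soon as \<open>G\<close> has a vertex. The lemma
  \<open>class_one_iff_chromatic_index\<close> below shows that colourability with \<open>d\<close> colours then
  means that the chromatic index is \<open>d\<close>.
\<close>

definition class_one :: "'a pair_pre_digraph \<Rightarrow> bool" where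
  "class_one G \<longleftrightarrow> (\<exists>d. regular_graph d G \<and> edge_colorable G d)"

definition external_partition :: "'a pair_pre_digraph \<Rightarrow> 'a set \<Rightarrow> 'a set \<Rightarrow> bool" where
  "external_partition G A B \<longleftrightarrow>
     A \<union> B = pverts G \<and> A \<inter> B = {} \<and> A \<noteq> {} \<and> B \<noteq> {} \<and>
     (\<forall>x \<in> A. real (degree_in G B x) \<ge> real (degree G x) / 2) \<and>
     (\<forall>x \<in> B. real (degree_in G A x) \<ge> real (degree G x) / 2)"

definition external_bisection :: "'a pair_pre_digraph \<Rightarrow> 'a set \<Rightarrow> 'a set \<Rightarrow> bool" where
  "external_bisection G A B \<longleftrightarrow> external_partition G A B \<and> card A = card B"

lemma degree_le_edge_colors:
  assumes "pair_graph G" "v \<in> pverts G" "edge_colorable G k"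
  shows "degree G v \<le> k"
proof -
  obtain c where c: "proper_edge_coloring G k c"
    using assms(3) by (auto simp: edge_colorable_def)
  let ?N = "{u \<in> pverts G. (v, u) \<in> parcs G}"
  have edge: "{v, u} \<in> edges G" if "u \<in> ?N" for u
    using that by (auto simp: edges_def)
  have "inj_on (\<lambda>u. c {v, u}) ?N"
  proof (rule inj_onI)
    fix x y assume xy: "x \<in> ?N" "y \<in> ?N" "c {v, x} = c {v, y}"
    have "{v, x} \<inter> {v, y} \<noteq> {}" by simp
    with c edge[OF xy(1)] edge[OF xy(2)] xy(3) have "{v, x} = {v, y}"
      unfolding proper_edge_coloring_def by metis
    then show "x = y" by (auto simp: doubleton_eq_iff)
  qed
  moreover have "(\<lambda>u. c {v, u}) ` ?N \<subseteq> {..<k}"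
    using c edge by (auto simp: proper_edge_coloring_def)
  ultimately have "card ?N \<le> card {..<k}"
    by (rule card_inj_on_le) simp
  then show ?thesis by (simp add: degree_def degree_in_def)
qed

lemma edge_colorable_exists:
  assumes "pair_graph G"
  shows "\<exists>k. edge_colorable G k"
proof -
  interpret pair_graph G by fact
  have "edges G = (\<lambda>(u, v). {u, v}) ` parcs G" by (auto simp: edges_def)
  then have "finite (edges G)" using pair_finite_arcs by simp
  from finite_imp_inj_to_nat_seg[OF this]
  obtain c :: "'a set \<Rightarrow> nat" and n where c: "c ` edges G = {i. i < n}" "inj_on c (edges G)"
    by blast
  have "c e < n" if "e \<in> edges G" for e
    using c(1) imageI[OF that, of c] by simp
  moreover have "c e \<noteq> c f" if "e \<in> edges G" "f \<in> edges G" "e \<noteq> f" for e f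
    using inj_on_contraD[OF c(2) that(3,1,2)] .
  ultimately have "proper_edge_coloring G n c"
    unfolding proper_edge_coloring_def by blast
  then show ?thesis by (auto simp: edge_colorable_def)
qed

lemma class_one_iff_chromatic_index:
  assumes G: "pair_graph G" "pverts G \<noteq> {}" and d: "regular_graph d G"
  shows "class_one G \<longleftrightarrow> chromatic_index G = d"
proof -
  obtain v where v: "v \<in> pverts G" using G(2) by blast
  have lower: "d \<le> k" if "edge_colorable G k" for k
    using degree_le_edge_colors[OF G(1) v that] d v by (simp add: regular_graph_def)
  have "class_one G \<longleftrightarrow> edge_colorable G d"
    using d v by (auto simp: class_one_def regular_graph_def)
  also have "\<dots> \<longleftrightarrow> chromatic_index G = d"
  proof
    assume "edge_colorable G d"
    then show "chromatic_index G = d"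
      unfolding chromatic_index_def by (rule Least_equality) (rule lower)
  next
    assume "chromatic_index G = d"
    with LeastI_ex[OF edge_colorable_exists[OF G(1)]] show "edge_colorable G d"
      by (simp add: chromatic_index_def)
  qed
  finally show ?thesis .
qed

end

theory Submission
  imports Defs
begin

text \<open>
  Any two colour classes of the colouring are perfect matchings, so together they form a bipartite
  spanning subgraph. Its two sides have equal size because each matching pairs them up, and every
  vertex has at least two neighbours on the other side, which is half of its degree or more.
\<close>

text \<open>The partner map of a perfect matching on \<open>V\<close>. No graph occurs in it, so a
  matching can be rewired along pairs that are not edges.\<close>

definition matching_involution :: "'a set \<Rightarrow> ('a \<Rightarrow> 'a) \<Rightarrow> bool" where
  "matching_involution V f \<longleftrightarrow> (\<forall>x \<in> V. f x \<in> V \<and> f x \<noteq> x \<and> f (f x) = x)"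

text \<open>The union of two perfect matchings consists of even cycles and doubled edges. Instead of
  tracing cycles, the induction deletes one pair of \<open>f\<close> and repairs \<open>g\<close> on
  the rest; hence \<open>g\<close> is generalised, while \<open>f\<close> is merely
  restricted.\<close>

lemma matching_involutions_two_colorable:
  assumes "finite V" "matching_involution V f" "matching_involution V g"
  shows "\<exists>h :: 'a \<Rightarrow> bool. \<forall>x \<in> V. h (f x) \<noteq> h x \<and> h (g x) \<noteq> h x"
  using assms
proof (induction V arbitrary: g rule: finite_psubset_induct)
  case (psubset V)
  note f = psubset.prems(1)[unfolded matching_involution_def]
  note g = psubset.prems(2)[unfolded matching_involution_def]
  show ?case
  proof (cases "V = {}")
    case False
    then obtain x where x: "x \<in> V" by blast
    define y W where "y = f x" and "W = V - {x, y}"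
    have y: "y \<in> V" "y \<noteq> x" "f y = x" using f x by (auto simp: y_def)
    have W: "W \<subset> V" using x by (auto simp: W_def)
    have fW: "matching_involution W f"
      unfolding matching_involution_def W_def using f x y
      by (metis DiffE DiffI insertE insertI1 insert_iff singletonD y_def)
    show ?thesis
    \<comment> \<open>If both matchings pair \<open>x\<close> with \<open>y\<close>, these two
      vertices form a component by themselves and just need opposite colours.\<close>
    proof (cases "g x = y")
      case True
      then have gy: "g y = x" using g x by blast
      have "matching_involution W g"
        unfolding matching_involution_def W_def using g x y True gy
        by (metis DiffE DiffI insertE insertI1 insert_iff singletonD)
      then obtain h :: "'a \<Rightarrow> bool" where h: "\<forall>z \<in> W. h (f z) \<noteq> h z \<and> h (g z) \<noteq> h z"
        using psubset.IH[OF W fW] by blast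
      have "z \<in> W \<Longrightarrow> f z \<in> W \<and> g z \<in> W" for z
        using fW \<open>matching_involution W g\<close> by (auto simp: matching_involution_def)
      then show ?thesis
        using h y True gy
        by (intro exI[of _ "h(x := True, y := False)"]) (auto simp: W_def y_def)
    next
      case False
      define a b where "a = g x" and "b = g y"
      have ab: "a \<in> W" "b \<in> W" "a \<noteq> b" "g a = x" "g b = y"
        using g x y False unfolding a_def b_def W_def by (auto, metis+)
      \<comment> \<open>Removing the path from \<open>a\<close> through \<open>x\<close> and \<open>y\<close> to \<open>b\<close> and joining its ends
        keeps the parity of the cycle.\<close>
      define g' where "g' = g(a := b, b := a)"
      have g'W: "matching_involution W g'"
        unfolding matching_involution_def
      proof
        fix z assume z: "z \<in> W"
        show "g' z \<in> W \<and> g' z \<noteq> z \<and> g' (g' z) = z"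
        proof (cases "z = a \<or> z = b")
          case True
          then show ?thesis using ab by (auto simp: g'_def)
        next
          case False
          have gz: "g z \<in> V" "g z \<noteq> z" "g (g z) = z" using g z by (auto simp: W_def)
          \<comment> \<open>The \<open>g\<close>-partners of \<open>x\<close>, \<open>y\<close>,
            \<open>a\<close>, \<open>b\<close> are \<open>a\<close>, \<open>b\<close>,
            \<open>x\<close>, \<open>y\<close>, and \<open>z\<close> is none of these.\<close>
          have "g z \<notin> {x, y, a, b}"
            using gz(3) False z ab by (auto simp: a_def b_def W_def)
          then show ?thesis using gz False by (auto simp: g'_def W_def)
        qed
      qed
      obtain h :: "'a \<Rightarrow> bool" where h: "\<forall>z \<in> W. h (f z) \<noteq> h z \<and> h (g' z) \<noteq> h z"
        using psubset.IH[OF W fW g'W] by blast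
      have hab: "h a \<noteq> h b" using h ab by (metis fun_upd_same g'_def)
      \<comment> \<open>The \<open>g\<close>-pairs \<open>x\<close>, \<open>a\<close> and
        \<open>y\<close>, \<open>b\<close> force these values. As \<open>h a\<close> and
        \<open>h b\<close> differ, \<open>x\<close> and \<open>y\<close> get different colours too,
        as their \<open>f\<close>-pair demands.\<close>
      define k where "k = h(x := \<not> h a, y := \<not> h b)"
      have kW: "k z = h z" if "z \<in> W" for z using that by (auto simp: k_def W_def)
      have kxy: "k x = (\<not> h a)" "k y = (\<not> h b)" using y by (auto simp: k_def)
      have "k (f z) \<noteq> k z \<and> k (g z) \<noteq> k z" if z: "z \<in> V" for z
      proof -
        consider "z = x" | "z = y" | "z = a" | "z = b" | "z \<in> W" "z \<noteq> a" "z \<noteq> b"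
          using z by (auto simp: W_def)
        then show ?thesis
        proof cases
          case 1
          then show ?thesis using kW[OF ab(1)] kxy hab by (simp flip: y_def a_def)
        next
          case 2
          then show ?thesis using kW[OF ab(2)] kxy hab y by (simp flip: b_def)
        next
          case 3
          then show ?thesis using h ab kW kxy fW by (simp add: matching_involution_def)
        next
          case 4
          then show ?thesis using h ab kW kxy fW by (simp add: matching_involution_def)
        next
          case 5
          then have "g' z = g z" by (simp add: g'_def)
          then show ?thesis using h 5 kW fW g'W by (metis matching_involution_def)
        qed
      qed
      then show ?thesis by blast
    qed
  qed simp
qed

text \<open>The \<open>d\<close> edges at a vertex have distinct colours among only
  \<open>d\<close>, so each colour occurs there exactly once.\<close>

lemma color_class_matching_involution:
  assumes G: "pair_graph G" and reg: "regular_graph d G"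
    and c: "proper_edge_coloring G d c" and i: "i < d"
  obtains f where "matching_involution (pverts G) f"
    "\<And>v. v \<in> pverts G \<Longrightarrow> (v, f v) \<in> parcs G \<and> c {v, f v} = i"
proof -
  interpret pair_graph G by fact
  let ?N = "\<lambda>v. {u \<in> pverts G. (v, u) \<in> parcs G}"
  have sym: "(u, v) \<in> parcs G" if "(v, u) \<in> parcs G" for u v
    using that by (rule arcs_symmetric)
  have inj: "inj_on (\<lambda>u. c {v, u}) (?N v)" for v
  proof (rule inj_onI)
    fix x y assume xy: "x \<in> ?N v" "y \<in> ?N v" "c {v, x} = c {v, y}"
    have "{v, x} \<in> edges G" "{v, y} \<in> edges G" "{v, x} \<inter> {v, y} \<noteq> {}"
      using xy by (auto simp: edges_def)
    with c xy(3) have "{v, x} = {v, y}"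
      unfolding proper_edge_coloring_def by metis
    then show "x = y" by (auto simp: doubleton_eq_iff)
  qed
  have "\<exists>u. u \<in> ?N v \<and> c {v, u} = i" if v: "v \<in> pverts G" for v
  proof -
    have "(\<lambda>u. c {v, u}) ` ?N v \<subseteq> {..<d}"
      using c by (auto simp: proper_edge_coloring_def edges_def)
    moreover have "card ((\<lambda>u. c {v, u}) ` ?N v) = card {..<d}"
      using reg v card_image[OF inj] by (simp add: regular_graph_def degree_def degree_in_def)
    ultimately have "(\<lambda>u. c {v, u}) ` ?N v = {..<d}"
      by (intro card_subset_eq) auto
    then have "i \<in> (\<lambda>u. c {v, u}) ` ?N v" using i by simp
    then show ?thesis by auto
  qed
  then obtain f where f: "\<And>v. v \<in> pverts G \<Longrightarrow> f v \<in> ?N v \<and> c {v, f v} = i"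
    by metis
  have "f v \<in> pverts G \<and> f v \<noteq> v \<and> f (f v) = v" if v: "v \<in> pverts G" for v
  proof -
    have fv: "f v \<in> pverts G" "(v, f v) \<in> parcs G" "c {v, f v} = i" using f[OF v] by auto
    have "f v \<noteq> v" using fv(2) pair_no_loops by fastforce
    \<comment> \<open>Both \<open>f (f v)\<close> and \<open>v\<close> are joined to
      \<open>f v\<close> by an edge of colour \<open>i\<close>, and colours at \<open>f v\<close>
      are distinct.\<close>
    moreover have "f (f v) = v"
      using inj_onD[OF inj[of "f v"], of "f (f v)" v] f[OF fv(1)] fv v sym
      by (simp add: insert_commute)
    ultimately show ?thesis using fv by blast
  qed
  then show thesis using that[of f] f by (auto simp: matching_involution_def)
qed

text \<open>The bound \<open>2 \<le> d\<close> supplies the colours 0 and 1;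
  \<open>d \<le> 4\<close> makes two neighbours across at least half of the degree.\<close>

lemma external_bisection_of_edge_coloring:
  assumes G: "pair_graph G" "pverts G \<noteq> {}" and reg: "regular_graph d G"
    and col: "edge_colorable G d" and d: "2 \<le> d" "d \<le> 4"
  shows "\<exists>A B. external_bisection G A B"
proof -
  interpret pair_graph G by (rule G)
  let ?V = "pverts G"
  obtain c where c: "proper_edge_coloring G d c" using col by (auto simp: edge_colorable_def)
  obtain f where f: "matching_involution ?V f"
    "\<And>v. v \<in> ?V \<Longrightarrow> (v, f v) \<in> parcs G \<and> c {v, f v} = 0"
    using color_class_matching_involution[OF G(1) reg c, of 0] d by auto
  obtain g where g: "matching_involution ?V g"
    "\<And>v. v \<in> ?V \<Longrightarrow> (v, g v) \<in> parcs G \<and> c {v, g v} = 1"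
    using color_class_matching_involution[OF G(1) reg c, of 1] d by auto
  obtain h :: "'a \<Rightarrow> bool" where h: "\<forall>x \<in> ?V. h (f x) \<noteq> h x \<and> h (g x) \<noteq> h x"
    using matching_involutions_two_colorable[OF pair_finite_verts f(1) g(1)] by blast
  define S where "S b = {x \<in> ?V. h x = b}" for b
  have fS: "f x \<in> S (\<not> b)" "g x \<in> S (\<not> b)" if "x \<in> S b" for x b
    using that h f(1) g(1) by (auto simp: S_def matching_involution_def)
  \<comment> \<open>\<open>f\<close> swaps the two sides and is its own inverse.\<close>
  have "bij_betw f (S True) (S False)"
    using fS[of _ True] fS[of _ False] f(1)
    by (intro bij_betw_byWitness[where f' = f]) (auto simp: S_def matching_involution_def)
  then have card: "card (S True) = card (S False)" by (rule bij_betw_same_card)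
  have deg: "real (degree_in G (S (\<not> b)) x) \<ge> real (degree G x) / 2" if x: "x \<in> S b" for x b
  proof -
    have xV: "x \<in> ?V" using x by (simp add: S_def)
    \<comment> \<open>The edges from \<open>x\<close> to these partners have colours 0 and 1, so the
      partners are two distinct neighbours.\<close>
    have "f x \<noteq> g x" using f(2)[OF xV] g(2)[OF xV] by auto
    then have "2 = card {f x, g x}" by simp
    also have "\<dots> \<le> degree_in G (S (\<not> b)) x"
      unfolding degree_in_def
      using fS[OF x] f(2)[OF xV] g(2)[OF xV]
      by (intro card_mono) (auto simp: S_def pair_finite_verts)
    finally show ?thesis using reg xV d by (simp add: regular_graph_def)
  qed
  have un: "S True \<union> S False = ?V" "S True \<inter> S False = {}" by (auto simp: S_def)
  \<comment> \<open>Some vertex lies on one side, and \<open>f\<close> sends it to the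
    other.\<close>
  moreover have "S True \<noteq> {}" "S False \<noteq> {}"
    using un G(2) fS[of _ True] fS[of _ False] by auto
  ultimately have "external_bisection G (S True) (S False)"
    using card deg[of _ True] deg[of _ False]
    by (simp add: external_bisection_def external_partition_def)
  then show ?thesis by blast
qed

theorem theorem4:
  fixes G :: "'a pair_pre_digraph"
  assumes "pair_graph G" and "pverts G \<noteq> {}"
    and "class_one G"
    and "regular_graph 3 G \<or> regular_graph 4 G"
  shows "\<exists>A B. external_bisection G A B"
proof -
  obtain d where d: "regular_graph d G" "edge_colorable G d"
    using assms(3) by (auto simp: class_one_def)
  \<comment> \<open>The degree of any one vertex identifies the \<open>d\<close> from
    \<open>class_one\<close> with 3 or 4.\<close>
  then have "d = 3 \<or> d = 4" using assms(2,4) by (auto simp: regular_graph_def)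
  then show ?thesis
    using external_bisection_of_edge_coloring[OF assms(1,2) d] by auto
qed

end
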